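(* For any positive integer $n$, $$\sum_{\substack{\lambda \in DD\\ |\lambda|= 2n}}\ \prod_{h \in \mathcal{H}(\lambda)}\frac{1}{h} = \frac{1}{2^n n!}.$$
   Context: A partition $\lambda=(\lambda_1\ge\dots\ge\lambda_\ell>0)$ has weight $|\lambda|=\sum\lambda_i$; its boxes are the pairs $(i,j)$ with $1\le i\le\ell$, $1\le j\le\lambda_i$; $\lambda^*$ is the conjugate partition. The hook length of $(i,j)$ is $\lambda_i-j+\lambda^*_j-i+1$, and $\mathcal H(\lambda)$ is the multiset of hook lengths of all boxes. The Durfee length is $D(\lambda)=\#\{i:\lambda_i\ge i\}$. $DD$ is the set of doubled distinct partitions, i.e. partitions $\lambda$ with $\lambda_i=\lambda_i^*+1$ for all $1\le i\le D(\lambda)$. *)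

theory Defs
  imports Complex_Main "HOL-Library.Multiset"
begin

definition is_partition :: "nat list \<Rightarrow> bool" where
  "is_partition xs \<longleftrightarrow> sorted_wrt (\<ge>) xs \<and> (\<forall>x\<in>set xs. 0 < x)"

text \<open>Parts are indexed from 1; outside the range \<open>1..length xs\<close> the part is 0.\<close>
definition part :: "nat list \<Rightarrow> nat \<Rightarrow> nat" where
  "part xs i = (if 1 \<le> i \<and> i \<le> length xs then xs ! (i - 1) else 0)"

definition weight :: "nat list \<Rightarrow> nat" where
  "weight xs = sum_list xs"

definition boxes :: "nat list \<Rightarrow> (nat \<times> nat) set" where
  "boxes xs = {(i, j). 1 \<le> i \<and> i \<le> length xs \<and> 1 \<le> j \<and> j \<le> part xs i}"

text \<open>The \<open>j\<close>-th part of the conjugate is the number of boxes in column \<open>j\<close>; for a partition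
  there are \<open>part xs 1\<close> nonempty columns.\<close>
definition conjugate :: "nat list \<Rightarrow> nat list" where
  "conjugate xs = map (\<lambda>j. card {i. (i, j) \<in> boxes xs}) [1..<part xs 1 + 1]"

text \<open>Both truncated differences are exact when \<open>(i, j)\<close> is a box of \<open>xs\<close>.\<close>
definition hook_length :: "nat list \<Rightarrow> nat \<times> nat \<Rightarrow> nat" where
  "hook_length xs = (\<lambda>(i, j). (part xs i - j) + (part (conjugate xs) j - i) + 1)"

definition hook_lengths :: "nat list \<Rightarrow> nat multiset" where
  "hook_lengths xs = image_mset (hook_length xs) (mset_set (boxes xs))"

definition durfee_length :: "nat list \<Rightarrow> nat" where
  "durfee_length xs = card {i. 1 \<le> i \<and> i \<le> length xs \<and> i \<le> part xs i}"

definition doubled_distinct :: "nat list set" where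
  "doubled_distinct = {xs. is_partition xs \<and>
     (\<forall>i. 1 \<le> i \<and> i \<le> durfee_length xs \<longrightarrow> part xs i = part (conjugate xs) i + 1)}"

text \<open>\<open>mset_set\<close> and \<open>sum\<close> are degenerate on infinite sets; the following two facts rule this out
  for the sets of boxes and of partitions of a given weight.\<close>
lemma finite_boxes: "finite (boxes xs)"
proof (rule finite_subset)
  show "boxes xs \<subseteq> (SIGMA i:{1..length xs}. {1..part xs i})"
    by (auto simp: boxes_def)
qed simp

lemma finite_partitions_of_weight: "finite {xs. is_partition xs \<and> weight xs = n}"
proof (rule finite_subset)
  have len: "length xs \<le> sum_list xs" if "\<forall>x\<in>set xs. 0 < x" for xs :: "nat list"
    using that by (induction xs) auto
  show "{xs. is_partition xs \<and> weight xs = n} \<subseteq> {xs. set xs \<subseteq> {..n} \<and> length xs \<le> n}"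
    using len by (auto simp: is_partition_def weight_def member_le_sum_list)
  show "finite {xs. set xs \<subseteq> {..n} \<and> length xs \<le> n}"
    by (rule finite_lists_length_le) simp
qed

end

theory Submission
  imports Defs
begin

text \<open>A doubled distinct partition of \<open>2n\<close> is determined by its arm lengths \<open>x\<^sub>1 > \<dots> > x\<^sub>D\<close> on the
  diagonal, which form an arbitrary strict partition \<open>A\<close> of \<open>n\<close>; the leg lengths are \<open>x\<^sub>i - 1\<close>.
  The hook length in position \<open>(i, j)\<close> of the Durfee square is \<open>x\<^sub>i + x\<^sub>j\<close>, and the other hook
  lengths in row \<open>i\<close> (column \<open>i\<close>) are the elements of \<open>{1..x\<^sub>i}\<close> (of \<open>{1..x\<^sub>i - 1}\<close>) that are not of
  the form \<open>x\<^sub>i - x\<^sub>k\<close> with \<open>k > i\<close>. Hence the product of the inverse hook lengths is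
  \<open>F(A)\<^sup>2 / 2\<^sup>D\<close> with \<open>F(A) = (\<Prod>i. 1 / x\<^sub>i!) (\<Prod>i<j. (x\<^sub>i - x\<^sub>j) / (x\<^sub>i + x\<^sub>j))\<close>. The sum of \<open>F(A)\<^sup>2 / 2\<^sup>D\<close> over
  the strict partitions of \<open>n\<close> is evaluated by induction on \<open>n\<close>: removing a box in all possible
  ways sums \<open>F\<close> to \<open>n F(A)\<close>, while adding a box in all possible ways, with weight \<open>1/2\<close> for a new
  part, sums \<open>F\<close> to \<open>F(A) / 2\<close>.\<close>

section \<open>Partial fractions and residue sums\<close>

text \<open>The residue at \<open>t = z i\<close> of
  \<open>\<Prod>j\<in>I. (t - y j) / (t - z j)\<close>, for distinct poles.\<close>

definition pf_residue :: "('i \<Rightarrow> 'a::field) \<Rightarrow> ('i \<Rightarrow> 'a) \<Rightarrow> 'i set \<Rightarrow> 'i \<Rightarrow> 'a" where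
  "pf_residue z y I i = (z i - y i) * (\<Prod>j\<in>I - {i}. (z i - y j) / (z i - z j))"

lemma pf_residue_insert:
  assumes "finite I" "k \<notin> I" "i \<in> I"
  shows "pf_residue z y (insert k I) i = pf_residue z y I i * ((z i - y k) / (z i - z k))"
proof -
  have "insert k I - {i} = insert k (I - {i})" using assms by auto
  then show ?thesis using assms by (simp add: pf_residue_def)
qed

lemma pf_residue_insert_self:
  assumes "k \<notin> I"
  shows "pf_residue z y (insert k I) k = (z k - y k) * (\<Prod>j\<in>I. (z k - y j) / (z k - z j))"
  using assms by (simp add: pf_residue_def)

text \<open>Induction on \<open>I\<close>: the expansion is multiplied by one more factor
  \<open>(t - y k) / (t - z k)\<close>. The residue at \<open>z k\<close> contains the old product
  evaluated at \<open>t = z k\<close>, which is why \<open>t\<close> is kept arbitrary.\<close>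

lemma partial_fractions:
  assumes "finite I" "inj_on z I" "t \<notin> z ` I"
  shows "(\<Prod>j\<in>I. (t - y j) / (t - z j)) = 1 + (\<Sum>i\<in>I. pf_residue z y I i / (t - z i))"
  using assms
proof (induction I arbitrary: t rule: finite_induct)
  case (insert k I)
  have zk: "z k \<notin> z ` I" and tk: "t \<noteq> z k" and inj: "inj_on z I" using insert by auto
  let ?R = "pf_residue z y I"
  \<comment> \<open>The left side collects all that \<open>?R i\<close> contributes once the residue
    at \<open>z k\<close> has been expanded by the induction hypothesis.\<close>
  have step: "?R i * ((z i - y k) / (z i - z k)) / (t - z i)
      + (z k - y k) * (?R i / (z k - z i)) / (t - z k) = ?R i / (t - z i) * ((t - y k) / (t - z k))"
    if "i \<in> I" for i
  proof -
    have ne: "z i - z k \<noteq> 0" "z k - z i \<noteq> 0" "t - z i \<noteq> 0" "t - z k \<noteq> 0"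
      using insert.prems that zk tk by (auto simp: image_iff)
    define p q where "p = z i - z k" and "q = t - z k"
    have e: "z k - z i = - p" "t - z i = q - p" "z i - y k = p + (z k - y k)"
      "t - y k = q + (z k - y k)" by (simp_all add: p_def q_def algebra_simps)
    have n: "p \<noteq> 0" "q \<noteq> 0" "q - p \<noteq> 0" using ne(1,4) ne(3)[unfolded e] by (simp_all add: p_def q_def)
    have "R * ((p + w) / p) / (q - p) + w * (R / (- p)) / q = R / (q - p) * ((q + w) / q)" for R w
    proof -
      have "w / p = (w / q) + (w * (q - p)) / (p * q)" using n by (simp add: field_simps)
      then show ?thesis using n by (simp add: add_divide_distrib distrib_left mult.commute)
    qed
    then show ?thesis unfolding e p_def[symmetric] q_def[symmetric] .
  qed
  have "(\<Sum>i\<in>insert k I. pf_residue z y (insert k I) i / (t - z i))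
      = (z k - y k) * (1 + (\<Sum>i\<in>I. ?R i / (z k - z i))) / (t - z k)
        + (\<Sum>i\<in>I. ?R i * ((z i - y k) / (z i - z k)) / (t - z i))"
    using insert.hyps insert.IH[OF inj zk]
    by (simp add: pf_residue_insert_self pf_residue_insert)
  also have "\<dots> = (z k - y k) / (t - z k) + (\<Sum>i\<in>I. ?R i * ((z i - y k) / (z i - z k)) / (t - z i)
      + (z k - y k) * (?R i / (z k - z i)) / (t - z k))"
    by (simp add: sum.distrib sum_distrib_left sum_divide_distrib distrib_left add_divide_distrib)
  also have "\<dots> = (z k - y k) / (t - z k) + (\<Sum>i\<in>I. ?R i / (t - z i)) * ((t - y k) / (t - z k))"
    by (simp only: sum.cong[OF refl step] sum_distrib_right)
  finally have "1 + (\<Sum>i\<in>insert k I. pf_residue z y (insert k I) i / (t - z i))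
      = (1 + (z k - y k) / (t - z k)) + (\<Sum>i\<in>I. ?R i / (t - z i)) * ((t - y k) / (t - z k))"
    by (simp only: add.assoc)
  also have "1 + (z k - y k) / (t - z k) = (t - y k) / (t - z k)"
    using tk by (simp add: divide_simps)
  finally show ?case using insert by (simp add: algebra_simps)
qed simp

text \<open>Heuristically, this compares the coefficients of \<open>1 / t\<close> at infinity in
  \<open>partial_fractions\<close>. The proof is an induction in which
  \<open>partial_fractions\<close> at \<open>t = z k\<close> expands the new residue.\<close>

lemma sum_pf_residue:
  assumes "finite I" "inj_on z I"
  shows "(\<Sum>i\<in>I. pf_residue z y I i) = (\<Sum>i\<in>I. z i - y i)"
  using assms
proof (induction I rule: finite_induct)
  case (insert k I)
  have zk: "z k \<notin> z ` I" and inj: "inj_on z I" using insert by auto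
  let ?R = "pf_residue z y I"
  have step: "?R i * ((z i - y k) / (z i - z k)) + (z k - y k) * (?R i / (z k - z i)) = ?R i"
    if "i \<in> I" for i
  proof -
    define p where "p = z i - z k"
    have e: "z k - z i = - p" "z i - y k = p + (z k - y k)" by (simp_all add: p_def)
    have n: "p \<noteq> 0" using that zk by (auto simp: p_def image_iff)
    have "R * ((p + w) / p) + w * (R / (- p)) = R" for R w
      using n by (simp add: add_divide_distrib distrib_left)
    then show ?thesis unfolding e p_def[symmetric] .
  qed
  have "(\<Sum>i\<in>insert k I. pf_residue z y (insert k I) i)
      = (z k - y k) * (1 + (\<Sum>i\<in>I. ?R i / (z k - z i))) + (\<Sum>i\<in>I. ?R i * ((z i - y k) / (z i - z k)))"
    using insert.hyps partial_fractions[OF \<open>finite I\<close> inj zk, of y]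
    by (simp add: pf_residue_insert_self pf_residue_insert)
  also have "\<dots> = (z k - y k) + (\<Sum>i\<in>I. ?R i * ((z i - y k) / (z i - z k))
      + (z k - y k) * (?R i / (z k - z i)))"
    by (simp add: sum.distrib sum_distrib_left distrib_left)
  also have "\<dots> = (z k - y k) + (\<Sum>i\<in>I. ?R i)"
    by (simp only: sum.cong[OF refl step])
  finally show ?case using insert by simp
qed simp

section \<open>Strict partitions and the branching rules for removing or adding a box\<close>

definition strict_partitions :: "nat \<Rightarrow> nat set set" where
  "strict_partitions n = {A. finite A \<and> 0 \<notin> A \<and> \<Sum>A = n}"

lemma finite_strict_partitions: "finite (strict_partitions n)"
proof (rule finite_subset)
  show "strict_partitions n \<subseteq> Pow {..n}"
    by (auto simp: strict_partitions_def intro: member_le_sum[where f = "\<lambda>x. x"])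
qed simp

text \<open>For a strict partition \<open>A\<close> of \<open>n\<close>, the number of standard shifted tableaux of shape \<open>A\<close>
  divided by \<open>n!\<close>.\<close>
definition shifted_dim :: "nat set \<Rightarrow> real" where
  "shifted_dim A = (\<Prod>a\<in>A. 1 / fact a * (\<Prod>b | b \<in> A \<and> b < a. (real a - real b) / (real a + real b)))"

text \<open>Every pair containing \<open>c\<close> occurs once, with the larger element first; the
  absolute value covers both orders.\<close>

lemma shifted_dim_insert:
  assumes "finite A" "c \<notin> A"
  shows "shifted_dim (insert c A)
    = shifted_dim A * (1 / fact c * (\<Prod>b\<in>A. \<bar>real c - real b\<bar> / (real c + real b)))"
proof -
  let ?f = "\<lambda>a b. (real a - real b) / (real a + real b)"
  have c: "{b. b \<in> insert c A \<and> b < c} = {b \<in> A. b < c}" by auto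
  have a: "(\<Prod>b | b \<in> insert c A \<and> b < a. ?f a b)
      = (if c < a then ?f a c else 1) * (\<Prod>b | b \<in> A \<and> b < a. ?f a b)" for a
  proof -
    have "{b. b \<in> insert c A \<and> b < a} = (if c < a then insert c {b \<in> A. b < a} else {b \<in> A. b < a})"
      by auto
    then show ?thesis using assms by simp
  qed
  have "shifted_dim (insert c A) = (1 / fact c * (\<Prod>b | b \<in> A \<and> b < c. ?f c b))
     * (\<Prod>a\<in>A. 1 / fact a * ((if c < a then ?f a c else 1) * (\<Prod>b | b \<in> A \<and> b < a. ?f a b)))"
    using assms unfolding shifted_dim_def by (subst prod.insert) (simp_all only: c a not_False_eq_True)
  also have "(\<Prod>b | b \<in> A \<and> b < c. ?f c b) = (\<Prod>b\<in>A. if b < c then ?f c b else 1)"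
    using assms(1) by (simp add: prod.inter_filter)
  also have "(\<Prod>a\<in>A. 1 / fact a * ((if c < a then ?f a c else 1) * (\<Prod>b | b \<in> A \<and> b < a. ?f a b)))
     = (\<Prod>a\<in>A. if c < a then ?f a c else 1) * shifted_dim A"
    unfolding shifted_dim_def prod.distrib[symmetric] by (rule prod.cong) simp_all
  also have "(1 / fact c * (\<Prod>b\<in>A. if b < c then ?f c b else 1)) *
     ((\<Prod>a\<in>A. if c < a then ?f a c else 1) * shifted_dim A)
    = shifted_dim A * (1 / fact c *
        (\<Prod>b\<in>A. (if b < c then ?f c b else 1) * (if c < b then ?f b c else 1)))"
    by (simp add: prod.distrib)
  also have "(\<Prod>b\<in>A. (if b < c then ?f c b else 1) * (if c < b then ?f b c else 1))
    = (\<Prod>b\<in>A. \<bar>real c - real b\<bar> / (real c + real b))"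
    using assms(2) by (intro prod.cong) (auto simp: add.commute)
  finally show ?thesis .
qed

text \<open>Each factor \<open>\<bar>0 - b\<bar> / (0 + b)\<close> is 1, so a part that shrinks to 0
  may be kept as a dummy part.\<close>

lemma shifted_dim_insert_zero: "finite A \<Longrightarrow> 0 \<notin> A \<Longrightarrow> shifted_dim (insert 0 A) = shifted_dim A"
proof -
  assume A: "finite A" "0 \<notin> A"
  have "(\<Prod>b\<in>A. \<bar>real 0 - real b\<bar> / (real 0 + real b)) = 1"
    using A by (intro prod.neutral) (auto intro: gr0I)
  then show ?thesis using shifted_dim_insert[OF A] by simp
qed

text \<open>Deleting \<open>0\<close> makes a part 1 disappear when it loses its box; conversely,
  \<open>add_box A 0\<close> creates a part 1.\<close>

abbreviation remove_box :: "nat set \<Rightarrow> nat \<Rightarrow> nat set" where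
  "remove_box A a \<equiv> insert (a - 1) (A - {a}) - {0}"

abbreviation add_box :: "nat set \<Rightarrow> nat \<Rightarrow> nat set" where
  "add_box A a \<equiv> insert (Suc a) (A - {a})"

text \<open>Distinct integers differ by at least 1, so a unit step of \<open>a\<close> cannot
  reverse the sign of the difference.\<close>

lemma abs_ratio:
  fixes a b :: nat and e :: real
  assumes "a \<noteq> b" "e = 1 \<or> e = -1"
  shows "\<bar>real a + e - real b\<bar> = \<bar>real a - real b\<bar> * ((real a + e - real b) / (real a - real b))"
proof -
  define d where "d = real a - real b"
  have d: "d \<le> -1 \<or> d \<ge> 1" using assms(1) unfolding d_def by linarith
  then have "d \<noteq> 0" by linarith
  from d assms(2) have "d \<le> 0 \<and> d + e \<le> 0 \<or> 0 \<le> d \<and> 0 \<le> d + e" by linarith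
  with \<open>d \<noteq> 0\<close> have "\<bar>d + e\<bar> * d = \<bar>d\<bar> * (d + e)"
    by (elim disjE) (simp_all add: abs_of_nonneg abs_of_nonpos algebra_simps)
  with \<open>d \<noteq> 0\<close> have "\<bar>d + e\<bar> = \<bar>d\<bar> * ((d + e) / d)" by (simp add: field_simps)
  then show ?thesis by (simp add: d_def algebra_simps)
qed

text \<open>Only the factors that involve \<open>a\<close> change. By \<open>abs_ratio\<close> the
  change is a rational expression without absolute values, comparable with
  \<open>pf_residue\<close>; \<open>e\<close> covers both directions.\<close>

lemma shifted_dim_move:
  fixes e :: real
  assumes "finite A" "0 \<notin> A" "a \<in> A" "c \<notin> A" "real c = real a + e" "e = 1 \<or> e = -1"
  shows "shifted_dim (insert c (A - {a})) = shifted_dim A * (fact a / fact c *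
    (\<Prod>b\<in>A - {a}. ((real a + e - real b) * (real a + real b)) / ((real a + e + real b) * (real a - real b))))"
proof -
  let ?B = "A - {a}"
  have A: "A = insert a ?B" using assms by auto
  have dA: "shifted_dim A = shifted_dim ?B * (1 / fact a * (\<Prod>b\<in>?B. \<bar>real a - real b\<bar> / (real a + real b)))"
    using shifted_dim_insert[of ?B a] assms A by auto
  have "(\<Prod>b\<in>?B. \<bar>real c - real b\<bar> / (real c + real b)) = 
    (\<Prod>b\<in>?B. \<bar>real a - real b\<bar> / (real a + real b)) *
    (\<Prod>b\<in>?B. ((real a + e - real b) * (real a + real b)) / ((real a + e + real b) * (real a - real b)))"
    unfolding prod.distrib[symmetric]
  proof (rule prod.cong, rule refl)
    fix b assume b: "b \<in> ?B"
    then have "0 < real b" using assms by (metis DiffD1 of_nat_0_less_iff gr0I)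
    then have "real a + real b \<noteq> 0" by linarith
    then show "\<bar>real c - real b\<bar> / (real c + real b) = \<bar>real a - real b\<bar> / (real a + real b) *
      (((real a + e - real b) * (real a + real b)) / ((real a + e + real b) * (real a - real b)))"
      using abs_ratio[of a b e] assms b by simp
  qed
  moreover have "shifted_dim (insert c ?B) = shifted_dim ?B * (1 / fact c * (\<Prod>b\<in>?B. \<bar>real c - real b\<bar> / (real c + real b)))"
    using shifted_dim_insert[of ?B c] assms by auto
  ultimately show ?thesis unfolding dA by (simp add: field_simps)
qed

lemma inj_on_pronic: "inj_on (\<lambda>x. real x * (real x + 1)) A"
proof (rule linorder_inj_onI')
  fix i j :: nat assume "i < j"
  then have "real i * (real i + 1) < real j * (real j + 1)" by (intro mult_strict_mono') auto
  then show "real i * (real i + 1) \<noteq> real j * (real j + 1)" by simp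
qed

text \<open>\<open>0\<close> is excluded because \<open>0\<close> and \<open>1\<close> give the same
  value.\<close>

lemma inj_on_pronic_pred:
  assumes "0 \<notin> A"
  shows "inj_on (\<lambda>x. real x * (real x - 1)) A"
proof (rule linorder_inj_onI')
  fix i j :: nat assume "i < j" "i \<in> A"
  moreover from this assms have "i > 0" by (cases i) auto
  ultimately have "real i * (real i - 1) < real j * (real j - 1)" by (intro mult_strict_mono') auto
  then show "real i * (real i - 1) \<noteq> real j * (real j - 1)" by simp
qed

text \<open>With \<open>y x = x * (x - 1)\<close> and \<open>z x = x * (x + 1)\<close>, lowering or raising the part \<open>a\<close> by 1
  multiplies \<open>shifted_dim\<close> by a multiple of a residue of \<open>\<Prod>x. (t - z x) / (t - y x)\<close> or of its
  inverse; the two branching identities are the residue sum of the former and the value at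
  \<open>t = 0\<close> of the latter.\<close>
lemma sum_remove_box:
  assumes "finite A" "0 \<notin> A"
  shows "(\<Sum>a | a \<in> A \<and> a - 1 \<notin> A. shifted_dim (remove_box A a)) = real (\<Sum>A) * shifted_dim A"
proof -
  let ?y = "\<lambda>x. real x * (real x - 1)" and ?z = "\<lambda>x. real x * (real x + 1)"
  have summand: "(if a - 1 \<notin> A then shifted_dim (remove_box A a) else 0)
      = shifted_dim A * (- (1/2) * pf_residue ?y ?z A a)" if a: "a \<in> A" for a
  proof -
    have pos: "a > 0" using a assms by (metis gr0I)
    \<comment> \<open>Here \<open>?y a - ?z b = (a - 1 - b) * (a + b)\<close> and
      \<open>?y a - ?y b = (a - b) * (a + b - 1)\<close>; the leading factor
      \<open>?y a - ?z a = - 2 * a\<close> accounts for \<open>- (1/2)\<close>.\<close>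
    have eq: "real a * (\<Prod>b\<in>A - {a}. ((real a + (-1) - real b) * (real a + real b)) / ((real a + (-1) + real b) * (real a - real b)))
      = - (1/2) * pf_residue ?y ?z A a"
    proof -
      have "(\<Prod>b\<in>A - {a}. ((real a + (-1) - real b) * (real a + real b)) / ((real a + (-1) + real b) * (real a - real b)))
         = (\<Prod>b\<in>A - {a}. (?y a - ?z b) / (?y a - ?y b))"
        by (intro prod.cong arg_cong2[where f = "(/)"]) (simp_all add: algebra_simps)
      then show ?thesis by (simp add: pf_residue_def algebra_simps)
    qed
    show ?thesis
    proof (cases "a - 1 \<in> A")
      \<comment> \<open>A part that cannot be lowered has residue 0, through the factor for
        \<open>b = a - 1\<close>, so the sum may run over all of \<open>A\<close>.\<close>
      case True
      have "(\<Prod>b\<in>A - {a}. ((real a + (-1) - real b) * (real a + real b)) / ((real a + (-1) + real b) * (real a - real b))) = 0"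
        using assms True pos by (intro prod_zero) (auto intro!: bexI[of _ "a - 1"] simp: of_nat_diff)
      then show ?thesis using eq True by simp
    next
      case False
      have "shifted_dim (remove_box A a) = shifted_dim (insert (a - 1) (A - {a}))"
      proof (cases "a = 1")
        case True
        then have "remove_box A a = A - {a}" using assms by auto
        then show ?thesis using True shifted_dim_insert_zero[of "A - {a}"] assms by simp
      next
        case False
        then have "remove_box A a = insert (a - 1) (A - {a})" using assms pos by auto
        then show ?thesis by simp
      qed
      also have "\<dots> = shifted_dim A * (fact a / fact (a - 1) * 
          (\<Prod>b\<in>A - {a}. ((real a + (-1) - real b) * (real a + real b)) / ((real a + (-1) + real b) * (real a - real b))))"
        using assms a False pos by (intro shifted_dim_move) (auto simp: of_nat_diff)
      also have "(fact a / fact (a - 1) :: real) = real a"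
        using pos by (cases a) auto
      finally show ?thesis using eq False by simp
    qed
  qed
  have "(\<Sum>a | a \<in> A \<and> a - 1 \<notin> A. shifted_dim (remove_box A a))
    = (\<Sum>a\<in>A. if a - 1 \<notin> A then shifted_dim (remove_box A a) else 0)"
    using assms by (intro sum.inter_filter) simp
  also have "\<dots> = shifted_dim A * (- (1/2) * (\<Sum>a\<in>A. pf_residue ?y ?z A a))"
    by (simp only: sum.cong[OF refl summand] sum_distrib_left)
  also have "(\<Sum>a\<in>A. pf_residue ?y ?z A a) = (\<Sum>a\<in>A. -2 * real a)"
    unfolding sum_pf_residue[OF assms(1) inj_on_pronic_pred[OF assms(2)]]
    by (rule sum.cong) (auto simp: algebra_simps)
  finally show ?thesis by (simp add: sum_distrib_left[symmetric] sum_negf)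
qed

lemma sum_add_box:
  assumes "finite A" "0 \<notin> A"
  shows "(\<Sum>a | a \<in> insert 0 A \<and> Suc a \<notin> A. shifted_dim (add_box A a) / (if a = 0 then 2 else 1))
    = shifted_dim A / 2"
proof -
  let ?y = "\<lambda>x. real x * (real x - 1)" and ?z = "\<lambda>x. real x * (real x + 1)"
  have summand: "(if Suc a \<notin> A then shifted_dim (add_box A a) / (if a = 0 then 2 else 1) else 0)
      = shifted_dim A * (- (1/2) * (pf_residue ?z ?y A a / (0 - ?z a)))" if a: "a \<in> A" for a
  proof -
    have pos: "a > 0" using a assms by (metis gr0I)
    have eq: "1 / (real a + 1) * (\<Prod>b\<in>A - {a}. ((real a + 1 - real b) * (real a + real b)) / ((real a + 1 + real b) * (real a - real b)))
      = - (1/2) * (pf_residue ?z ?y A a / (0 - ?z a))"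
    proof -
      have *: "(\<Prod>b\<in>A - {a}. ((real a + 1 - real b) * (real a + real b)) / ((real a + 1 + real b) * (real a - real b)))
         = (\<Prod>b\<in>A - {a}. (?z a - ?y b) / (?z a - ?z b))"
        by (intro prod.cong arg_cong2[where f = "(/)"]) (simp_all add: algebra_simps)
      have z: "?z a - ?y a = 2 * real a" by (simp add: algebra_simps)
      have "1 / (real a + 1) * P = - (1/2) * (2 * real a * P / (0 - ?z a))" for P
        using pos by (simp add: divide_simps)
      then show ?thesis unfolding * pf_residue_def z .
    qed
    show ?thesis
    proof (cases "Suc a \<in> A")
      case True
      have "(\<Prod>b\<in>A - {a}. ((real a + 1 - real b) * (real a + real b)) / ((real a + 1 + real b) * (real a - real b))) = 0"
        using assms True pos by (intro prod_zero) (auto intro!: bexI[of _ "Suc a"])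
      then show ?thesis using eq True by simp
    next
      case False
      have "shifted_dim (add_box A a) = shifted_dim A * (fact a / fact (Suc a) * 
          (\<Prod>b\<in>A - {a}. ((real a + 1 - real b) * (real a + real b)) / ((real a + 1 + real b) * (real a - real b))))"
        using assms a False pos by (intro shifted_dim_move) auto
      also have "(fact a / fact (Suc a) :: real) = 1 / (real a + 1)"
        unfolding fact_Suc by (simp add: add.commute)
      finally show ?thesis unfolding eq using False pos by simp
    qed
  qed
  \<comment> \<open>A new part 1 contributes half the value at \<open>t = 0\<close> of the product
    to be expanded, as \<open>?y j / ?z j = (j - 1) / (j + 1)\<close>.\<close>
  have zero: "(if Suc 0 \<notin> A then shifted_dim (add_box A 0) / 2 else 0) = shifted_dim A / 2 *
     (\<Prod>j\<in>A. (0 - ?y j) / (0 - ?z j))"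
  proof (cases "Suc 0 \<in> A")
    case True
    then have "(\<Prod>j\<in>A. (0 - ?y j) / (0 - ?z j)) = 0"
      using assms by (intro prod_zero) (auto intro!: bexI[of _ "Suc 0"])
    then show ?thesis using True by simp
  next
    case False
    have "(\<Prod>j\<in>A. (0 - ?y j) / (0 - ?z j)) = (\<Prod>b\<in>A. \<bar>real (Suc 0) - real b\<bar> / (real (Suc 0) + real b))"
    proof (rule prod.cong, rule refl)
      fix b assume "b \<in> A"
      then have "real b \<ge> 1" using assms by (cases b) auto
      then have "(0 - ?y b) / (0 - ?z b) = (real b - 1) / (real b + 1)" by simp
      also have "\<dots> = \<bar>real (Suc 0) - real b\<bar> / (real (Suc 0) + real b)"
        using \<open>real b \<ge> 1\<close> by (simp add: add.commute)
      finally show "(0 - ?y b) / (0 - ?z b) = \<bar>real (Suc 0) - real b\<bar> / (real (Suc 0) + real b)" .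
    qed
    then show ?thesis using shifted_dim_insert[OF assms(1) False] False assms by simp
  qed
  have "0 \<notin> ?z ` A"
    using assms(2) by (auto simp: add_eq_0_iff)
  then have pf: "(\<Prod>j\<in>A. (0 - ?y j) / (0 - ?z j)) = 1 + (\<Sum>a\<in>A. pf_residue ?z ?y A a / (0 - ?z a))"
    using assms by (intro partial_fractions inj_on_pronic)
  have "(\<Sum>a | a \<in> insert 0 A \<and> Suc a \<notin> A. shifted_dim (add_box A a) / (if a = 0 then 2 else 1))
    = (\<Sum>a\<in>insert 0 A. if Suc a \<notin> A then shifted_dim (add_box A a) / (if a = 0 then 2 else 1) else 0)"
    using assms by (intro sum.inter_filter) simp
  also have "\<dots> = (if Suc 0 \<notin> A then shifted_dim (add_box A 0) / 2 else 0)
     + (\<Sum>a\<in>A. if Suc a \<notin> A then shifted_dim (add_box A a) / (if a = 0 then 2 else 1) else 0)"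
    using assms by (subst sum.insert) auto
  \<comment> \<open>The weight \<open>1/2\<close> of a new part makes the residues cancel; the
    constant term 1 of the expansion survives.\<close>
  also have "\<dots> = shifted_dim A / 2 * (1 + (\<Sum>a\<in>A. pf_residue ?z ?y A a / (0 - ?z a)))
      + shifted_dim A * (- (1/2) * (\<Sum>a\<in>A. pf_residue ?z ?y A a / (0 - ?z a)))"
    by (simp only: zero pf sum.cong[OF refl summand] sum_distrib_left)
  also have "\<dots> = shifted_dim A / 2" by (simp add: algebra_simps)
  finally show ?thesis .
qed

text \<open>Together with \<open>add_box_props\<close> this makes removal and addition mutually
  inverse on pairs of a strict partition and a position. Position 0 stands for a part that vanishes,
  the only case in which \<open>card\<close> drops.\<close>

lemma remove_box_props:
  assumes "A \<in> strict_partitions (Suc n)" "a \<in> A" "a - 1 \<notin> A"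
  shows "remove_box A a \<in> strict_partitions n" "a - 1 \<in> insert 0 (remove_box A a)"
    "Suc (a - 1) \<notin> remove_box A a" "add_box (remove_box A a) (a - 1) = A"
    "card A = card (remove_box A a) + (if a - 1 = 0 then 1 else 0)"
proof -
  have A: "finite A" "0 \<notin> A" "\<Sum>A = Suc n" and pos: "a > 0"
    using assms by (auto simp: strict_partitions_def intro: gr0I)
  have s: "\<Sum>A = a + \<Sum>(A - {a})" and c: "card A = Suc (card (A - {a}))"
    using A assms sum.remove[of A a "\<lambda>x. x"] card.remove[of A a] by simp_all
  have r: "remove_box A a = (if a = 1 then A - {a} else insert (a - 1) (A - {a}))"
    using A pos by auto
  have "\<Sum>(remove_box A a) = n" unfolding r using A s pos assms by auto
  then show "remove_box A a \<in> strict_partitions n" using A by (simp add: strict_partitions_def)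
  show "card A = card (remove_box A a) + (if a - 1 = 0 then 1 else 0)"
    unfolding r using A c pos assms by auto
  show "a - 1 \<in> insert 0 (remove_box A a)" "Suc (a - 1) \<notin> remove_box A a"
    using pos by auto
  show "add_box (remove_box A a) (a - 1) = A" using A pos assms by auto
qed

lemma add_box_props:
  assumes "A \<in> strict_partitions n" "a \<in> insert 0 A" "Suc a \<notin> A"
  shows "add_box A a \<in> strict_partitions (Suc n)" "Suc a \<in> add_box A a" "a \<notin> add_box A a"
    "remove_box (add_box A a) (Suc a) = A"
proof -
  have A: "finite A" "0 \<notin> A" "\<Sum>A = n"
    using assms by (auto simp: strict_partitions_def)
  have "\<Sum>A = a + \<Sum>(A - {a})"
    using A assms sum.remove[of A a "\<lambda>x. x"] by (cases "a = 0") auto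
  then have "\<Sum>(add_box A a) = Suc n" using A assms by auto
  then show "add_box A a \<in> strict_partitions (Suc n)" using A by (simp add: strict_partitions_def)
  show "Suc a \<in> add_box A a" "a \<notin> add_box A a" by auto
  show "remove_box (add_box A a) (Suc a) = A" using A assms by auto
qed

text \<open>Only one of the two factors \<open>shifted_dim A\<close> is expanded over removable
  boxes. After exchanging the sums, the other one is summed over the addable boxes of the smaller
  partition.\<close>

lemma sum_shifted_dim_squared:
  "(\<Sum>A\<in>strict_partitions n. (shifted_dim A)\<^sup>2 / 2 ^ card A) = 1 / (2 ^ n * fact n)"
proof (induction n)
  case 0
  have "strict_partitions 0 = {{}}"
    by (force simp: strict_partitions_def)
  then show ?case by (simp add: shifted_dim_def)
next
  case (Suc n)
  let ?F = shifted_dim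
  let ?w = "\<lambda>A a. ?F A / (if a = 0 then 2 else 1)"
  have "real (Suc n) * (\<Sum>A\<in>strict_partitions (Suc n). (?F A)\<^sup>2 / 2 ^ card A)
     = (\<Sum>A\<in>strict_partitions (Suc n). ?F A / 2 ^ card A * (real (\<Sum>A) * ?F A))"
    by (auto simp: sum_distrib_left strict_partitions_def power2_eq_square intro!: sum.cong)
  also have "\<dots> = (\<Sum>A\<in>strict_partitions (Suc n). \<Sum>a | a \<in> A \<and> a - 1 \<notin> A.
      ?F A / 2 ^ card A * ?F (remove_box A a))"
  proof (rule sum.cong[OF refl])
    fix A assume "A \<in> strict_partitions (Suc n)"
    then have "finite A" "0 \<notin> A" by (auto simp: strict_partitions_def)
    then show "?F A / 2 ^ card A * (real (\<Sum>A) * ?F A) = (\<Sum>a | a \<in> A \<and> a - 1 \<notin> A.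
      ?F A / 2 ^ card A * ?F (remove_box A a))"
      by (simp only: sum_remove_box[OF \<open>finite A\<close> \<open>0 \<notin> A\<close>, symmetric] sum_distrib_left)
  qed
  also have "\<dots> = (\<Sum>(A, a)\<in>(SIGMA A:strict_partitions (Suc n). {a. a \<in> A \<and> a - 1 \<notin> A}).
      ?F A / 2 ^ card A * ?F (remove_box A a))"
    by (rule sum.Sigma) (auto simp: finite_strict_partitions, auto simp: strict_partitions_def)
  \<comment> \<open>Now \<open>A\<close> is the smaller partition; the factor 2 lost from
    \<open>2 ^ card A\<close> when a part disappears becomes the weight in
    \<open>?w\<close>.\<close>
  also have "\<dots> = (\<Sum>(A, a)\<in>(SIGMA A:strict_partitions n. {a. a \<in> insert 0 A \<and> Suc a \<notin> A}).
      ?F A / 2 ^ card A * ?w (add_box A a) a)"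
  proof (rule sum.reindex_bij_witness[where i = "\<lambda>(A, a). (add_box A a, Suc a)"
        and j = "\<lambda>(A, a). (remove_box A a, a - 1)"], goal_cases)
    case (1 p)
    obtain A a where p: "p = (A, a)" "A \<in> strict_partitions (Suc n)" "a \<in> A" "a - 1 \<notin> A"
      using 1 by auto
    then have "a > 0" by (auto simp: strict_partitions_def intro: gr0I)
    then show ?case using remove_box_props(4)[OF p(2-4)] by (simp add: p(1))
  next
    case (2 p)
    then obtain A a where p: "p = (A, a)" "A \<in> strict_partitions (Suc n)" "a \<in> A" "a - 1 \<notin> A"
      by auto
    show ?case using remove_box_props(1-3)[OF p(2-4)] unfolding p(1) prod.case by blast
  next
    case (3 p)
    then obtain A a where p: "p = (A, a)" "A \<in> strict_partitions n" "a \<in> insert 0 A" "Suc a \<notin> A"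
      by auto
    show ?case using add_box_props(4)[OF p(2-4)] unfolding p(1) by simp
  next
    case (4 p)
    then obtain A a where p: "p = (A, a)" "A \<in> strict_partitions n" "a \<in> insert 0 A" "Suc a \<notin> A"
      by auto
    show ?case using add_box_props(1-3)[OF p(2-4)] unfolding p(1) by simp
  next
    case (5 p)
    then obtain A a where p: "p = (A, a)" "A \<in> strict_partitions (Suc n)" "a \<in> A" "a - 1 \<notin> A"
      by auto
    define B where "B = remove_box A a"
    have "card A = card B + (if a - 1 = 0 then 1 else 0)" "add_box B (a - 1) = A"
      using remove_box_props[OF p(2-4)] unfolding B_def by auto
    then show ?case unfolding p(1) prod.case B_def[symmetric] by (simp add: field_simps)
  qed
  also have "\<dots> = (\<Sum>A\<in>strict_partitions n. \<Sum>a | a \<in> insert 0 A \<and> Suc a \<notin> A.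
      ?F A / 2 ^ card A * ?w (add_box A a) a)"
  proof (rule sum.Sigma[symmetric])
    show "\<forall>A\<in>strict_partitions n. finite {a \<in> insert 0 A. Suc a \<notin> A}"
      by (auto simp: strict_partitions_def)
  qed (rule finite_strict_partitions)
  also have "\<dots> = (\<Sum>A\<in>strict_partitions n. (?F A)\<^sup>2 / 2 ^ card A / 2)"
  proof (rule sum.cong[OF refl])
    fix A assume "A \<in> strict_partitions n"
    then have "finite A" "0 \<notin> A" by (auto simp: strict_partitions_def)
    then show "(\<Sum>a | a \<in> insert 0 A \<and> Suc a \<notin> A. ?F A / 2 ^ card A * ?w (add_box A a) a)
      = (?F A)\<^sup>2 / 2 ^ card A / 2"
      by (simp only: sum_distrib_left[symmetric] sum_add_box[OF \<open>finite A\<close> \<open>0 \<notin> A\<close>]) (simp add: power2_eq_square)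
  qed
  also have "\<dots> = 1 / (2 ^ n * fact n) / 2"
    unfolding Suc.IH[symmetric] by (simp add: sum_divide_distrib)
  finally have "(\<Sum>A\<in>strict_partitions (Suc n). (?F A)\<^sup>2 / 2 ^ card A)
      = 1 / (2 ^ n * fact n) / 2 / real (Suc n)"
    by (simp add: eq_divide_eq mult_ac del: of_nat_Suc)
  then show ?case by (simp add: mult_ac)
qed

section \<open>Young diagrams, Durfee squares and hook lengths\<close>

text \<open>The set is the interval \<open>{1..card S}\<close>. Conjugate parts and Durfee lengths,
  defined as cardinalities, thereby become threshold conditions.\<close>

lemma down_closed_mem_iff:
  fixes S :: "nat set"
  assumes "finite S" "\<And>i k. k \<in> S \<Longrightarrow> 1 \<le> i \<Longrightarrow> i \<le> k \<Longrightarrow> i \<in> S" "0 \<notin> S" "1 \<le> i"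
  shows "i \<in> S \<longleftrightarrow> i \<le> card S"
proof -
  have "S = {1..card S}"
  proof (cases "S = {}")
    case False
    have "S = {1..Max S}"
    proof (intro equalityI subsetI)
      fix k assume "k \<in> S"
      then show "k \<in> {1..Max S}" using assms(1,3) by (cases k) auto
    next
      fix k assume "k \<in> {1..Max S}"
      then show "k \<in> S" using assms(2)[OF Max_in[OF assms(1) False]] by auto
    qed
    then show ?thesis by (metis card_atLeastAtMost diff_Suc_1)
  qed auto
  then show ?thesis using assms(4) by (metis atLeastAtMost_iff)
qed

text \<open>Swapping the products reflects the triangle below the diagonal onto the one above. It is
  meant for the hook lengths \<open>x i + x j\<close> in the Durfee square.\<close>

lemma prod_symmetric_square:
  fixes f :: "nat \<Rightarrow> nat \<Rightarrow> 'a::comm_monoid_mult"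
  assumes "\<And>i j. f i j = f j i"
  shows "(\<Prod>i\<in>{1..D}. \<Prod>j\<in>{1..D}. f i j) = (\<Prod>i\<in>{1..D}. f i i * (\<Prod>k\<in>{i<..D}. f i k)\<^sup>2)"
proof -
  have row: "(\<Prod>j\<in>{1..D}. f i j) = (\<Prod>j | j \<in> {1..D} \<and> j < i. f i j) * (f i i * (\<Prod>j\<in>{i<..D}. f i j))"
    if "i \<in> {1..D}" for i
  proof -
    have "{1..D} = {j. j \<in> {1..D} \<and> j < i} \<union> insert i {i<..D}" using that by auto
    then have "(\<Prod>j\<in>{1..D}. f i j) = (\<Prod>j\<in>{j. j \<in> {1..D} \<and> j < i} \<union> insert i {i<..D}. f i j)"
      by (rule arg_cong)
    also have "\<dots> = (\<Prod>j | j \<in> {1..D} \<and> j < i. f i j) * (f i i * (\<Prod>j\<in>{i<..D}. f i j))"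
      by (subst prod.union_disjoint) auto
    finally show ?thesis .
  qed
  have "(\<Prod>i\<in>{1..D}. \<Prod>j | j \<in> {1..D} \<and> j < i. f i j) = (\<Prod>j\<in>{1..D}. \<Prod>i | i \<in> {1..D} \<and> j < i. f i j)"
    by (rule prod.swap_restrict) auto
  also have "\<dots> = (\<Prod>j\<in>{1..D}. \<Prod>i\<in>{j<..D}. f j i)"
    by (intro prod.cong) (auto simp: assms)
  finally have lower: "(\<Prod>i\<in>{1..D}. \<Prod>j | j \<in> {1..D} \<and> j < i. f i j) = \<dots>" .
  have "(\<Prod>i\<in>{1..D}. \<Prod>j\<in>{1..D}. f i j)
      = (\<Prod>i\<in>{1..D}. \<Prod>j | j \<in> {1..D} \<and> j < i. f i j) * (\<Prod>i\<in>{1..D}. f i i * (\<Prod>j\<in>{i<..D}. f i j))"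
    by (simp only: prod.cong[OF refl row] prod.distrib)
  then show ?thesis unfolding lower by (simp add: prod.distrib power2_eq_square mult_ac)
qed

text \<open>Read backwards, both enumerations are the strictly increasing list of the same
  set.\<close>

lemma strictly_decreasing_enumeration_unique:
  fixes x y :: "nat \<Rightarrow> nat"
  assumes x: "\<And>i k. 1 \<le> i \<Longrightarrow> i < k \<Longrightarrow> k \<le> D \<Longrightarrow> x k < x i"
    and y: "\<And>i k. 1 \<le> i \<Longrightarrow> i < k \<Longrightarrow> k \<le> D \<Longrightarrow> y k < y i"
    and "x ` {1..D} = y ` {1..D}" "1 \<le> i" "i \<le> D"
  shows "x i = y i"
proof -
  let ?l = "\<lambda>z. map z (rev [1..<Suc D])"
  have s: "sorted_wrt (<) (?l z)" if "\<And>i k. 1 \<le> i \<Longrightarrow> i < k \<Longrightarrow> k \<le> D \<Longrightarrow> z k < z i" for z :: "nat \<Rightarrow> nat"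
  proof -
    have "sorted_wrt (\<lambda>i k. z k < z i) [1..<Suc D]"
      using that by (intro sorted_wrt_mono_rel[OF _ sorted_wrt_upt]) auto
    then show ?thesis by (simp only: rev_map[symmetric] sorted_wrt_rev sorted_wrt_map)
  qed
  have "?l x = ?l y"
    using assms(3) by (intro strict_sorted_equal s x y) (simp_all add: atLeastLessThanSuc_atLeastAtMost del: upt_Suc)
  then show ?thesis using assms(4,5) by (auto simp: map_eq_conv simp del: upt_Suc)
qed

text \<open>A Young diagram given by its rows \<open>r\<close> and columns \<open>c\<close>, both indexed from 1; the
  assumptions are invariant under transposition.\<close>
locale young =
  fixes r c :: "nat \<Rightarrow> nat" and D :: nat
  assumes row_col: "1 \<le> i \<Longrightarrow> 1 \<le> j \<Longrightarrow> j \<le> r i \<longleftrightarrow> i \<le> c j"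
    and durfee: "1 \<le> i \<Longrightarrow> i \<le> r i \<longleftrightarrow> i \<le> D"
begin

lemma transpose: "young c r D"
  by unfold_locales (use row_col durfee in blast)+

text \<open>The column through the last box of row \<open>k\<close> also meets row
  \<open>i\<close>.\<close>

lemma row_antimono: "1 \<le> i \<Longrightarrow> i \<le> k \<Longrightarrow> r k \<le> r i"
  using row_col[of k "r k"] row_col[of i "r k"] by (cases "r k = 0") auto

lemma durfee_le_row: "1 \<le> i \<Longrightarrow> i \<le> D \<Longrightarrow> D \<le> r i"
  using row_antimono[of i D] durfee[of D] by auto

text \<open>The diagonal box at the smaller of the two coordinates lies in the diagram.\<close>

lemma mem_durfee: "1 \<le> i \<Longrightarrow> 1 \<le> j \<Longrightarrow> j \<le> r i \<Longrightarrow> i \<le> D \<or> j \<le> D"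
  using durfee[of i] durfee[of j] row_antimono[of j i] by (cases "i \<le> j") auto

lemma arm_strict_decreasing: "1 \<le> i \<Longrightarrow> i < k \<Longrightarrow> k \<le> D \<Longrightarrow> r k - k < r i - i"
  using row_antimono[of i k] durfee[of k] by simp

text \<open>In row \<open>i\<close>, the hook lengths outside the Durfee square are complementary in
  \<open>{1..r i - i}\<close> to the differences between the arm \<open>r i - i\<close> and the smaller arms.\<close>
lemma row_product:
  assumes "1 \<le> i" "i \<le> D"
  shows "(\<Prod>j\<in>{D<..r i}. (r i - j) + (c j - i) + 1) * (\<Prod>k\<in>{i<..D}. (r i - i) - (r k - k))
    = fact (r i - i)"
proof -
  interpret t: young c r D by (rule transpose)
  let ?f = "\<lambda>j. (r i - j) + (c j - i) + 1" and ?g = "\<lambda>k. (r i - i) - (r k - k)"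
  let ?S = "?f ` {D<..r i}" and ?T = "?g ` {i<..D}"
  have j: "i \<le> c j \<and> c j < j \<and> j \<le> r i" if "j \<in> {D<..r i}" for j
    using that assms row_col[of i j] t.durfee[of j] by auto
  have k: "k \<le> r k \<and> r k - k < r i - i \<and> i < k" if "k \<in> {i<..D}" for k
    using that assms durfee[of k] arm_strict_decreasing[of i k] by auto
  have injf: "inj_on ?f {D<..r i}"
  proof (rule linorder_inj_onI')
    fix j j' assume "j \<in> {D<..r i}" "j' \<in> {D<..r i}" "j < j'"
    then show "?f j \<noteq> ?f j'" using j[of j] j[of j'] t.row_antimono[of j j'] by simp
  qed
  have injg: "inj_on ?g {i<..D}"
  proof (rule linorder_inj_onI')
    fix k k' assume "k \<in> {i<..D}" "k' \<in> {i<..D}" "k < k'"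
    then show "?g k \<noteq> ?g k'"
      using k[of k] k[of k'] arm_strict_decreasing[of k k'] assms by auto
  qed
  \<comment> \<open>Equality of \<open>?f j\<close> and \<open>?g k\<close> would mean
    \<open>c j + r k + 1 = j + k\<close>. The left side is larger if \<open>(k, j)\<close> is a box
    of the diagram and smaller if it is not.\<close>
  have disj: "?S \<inter> ?T = {}"
  proof -
    have "?f j \<noteq> ?g k" if "j \<in> {D<..r i}" "k \<in> {i<..D}" for j k
      using that j[of j] k[of k] row_col[of k j] assms by (cases "j \<le> r k") auto
    then show ?thesis by blast
  qed
  have "D \<le> r i" using durfee_le_row assms by blast
  \<comment> \<open>The two disjoint sets have \<open>r i - D\<close> and \<open>D - i\<close>
    elements, enough to exhaust the interval.\<close>
  have "?S \<union> ?T = {1..r i - i}"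
  proof (rule card_subset_eq)
    show "?S \<union> ?T \<subseteq> {1..r i - i}"
    proof (intro Un_least image_subsetI)
      fix a assume "a \<in> {D<..r i}"
      then show "?f a \<in> {1..r i - i}" using j[of a] by auto
    next
      fix a assume "a \<in> {i<..D}"
      then show "?g a \<in> {1..r i - i}" using k[of a] by auto
    qed
    have "card (?S \<union> ?T) = card ?S + card ?T" by (rule card_Un_disjoint) (use disj in auto)
    also have "\<dots> = card {1..r i - i}"
      unfolding card_image[OF injf] card_image[OF injg] using \<open>D \<le> r i\<close> assms by simp
    finally show "card (?S \<union> ?T) = card {1..r i - i}" .
  qed simp
  then have "fact (r i - i) = \<Prod>(?S \<union> ?T)"
    by (simp add: fact_prod)
  also have "\<dots> = \<Prod>?S * \<Prod>?T" by (rule prod.union_disjoint) (use disj in auto)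
  also have "\<dots> = prod ?f {D<..r i} * prod ?g {i<..D}"
    using prod.reindex[OF injf, of "\<lambda>x. x"] prod.reindex[OF injg, of "\<lambda>x. x"] by (simp only: o_def)
  finally show ?thesis by simp
qed

text \<open>\<open>row_product\<close> divided through in the reals; applied to the transpose, it
  handles the columns as well.\<close>

lemma row_product_inverse:
  assumes "1 \<le> i" "i \<le> D"
  shows "(\<Prod>j\<in>{D<..r i}. 1 / real ((r i - j) + (c j - i) + 1))
    = (\<Prod>k\<in>{i<..D}. real (r i - i) - real (r k - k)) / fact (r i - i)"
proof -
  let ?P = "\<Prod>k\<in>{i<..D}. real (r i - i) - real (r k - k)"
  have "?P = (\<Prod>k\<in>{i<..D}. real ((r i - i) - (r k - k)))"
  proof (rule prod.cong[OF refl])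
    fix k assume "k \<in> {i<..D}"
    then have "r k - k \<le> r i - i" using arm_strict_decreasing[of i k] assms by auto
    then show "real (r i - i) - real (r k - k) = real ((r i - i) - (r k - k))"
      by (simp only: of_nat_diff)
  qed
  then have eq: "(\<Prod>j\<in>{D<..r i}. real ((r i - j) + (c j - i) + 1)) * ?P = fact (r i - i)"
    using arg_cong[OF row_product[OF assms], of real] by (simp only: of_nat_mult of_nat_prod of_nat_fact)
  have "fact (r i - i) \<noteq> (0 :: real)" by simp
  then have P: "?P \<noteq> 0" unfolding eq[symmetric] by (rule mult_not_zero[THEN conjunct2])
  show ?thesis unfolding eq[symmetric]
    by (simp only: nonzero_divide_mult_cancel_right[OF P] prod_dividef prod.neutral_const)
qed

definition diagram :: "(nat \<times> nat) set" where
  "diagram = {(i, j). 1 \<le> i \<and> 1 \<le> j \<and> j \<le> r i}"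

definition hook :: "nat \<times> nat \<Rightarrow> nat" where
  "hook = (\<lambda>(i, j). (r i - j) + (c j - i) + 1)"

text \<open>By \<open>mem_durfee\<close>, the boxes outside the Durfee square lie to its right or
  below it. The lower piece is indexed by columns, hence the swap, to mirror the right one.\<close>

lemma diagram_split:
  "diagram = ({1..D} \<times> {1..D} \<union> (SIGMA i:{1..D}. {D<..r i})) \<union> prod.swap ` (SIGMA j:{1..D}. {D<..c j})"
  (is "_ = (?A \<union> ?B) \<union> ?C")
proof (intro equalityI subsetI)
  fix p assume "p \<in> diagram"
  then obtain i j where p: "p = (i, j)" "1 \<le> i" "1 \<le> j" "j \<le> r i" by (auto simp: diagram_def)
  then show "p \<in> (?A \<union> ?B) \<union> ?C"
    using mem_durfee[of i j] row_col[of i j] by (cases "i \<le> D"; cases "j \<le> D") force+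
next
  fix p assume p: "p \<in> (?A \<union> ?B) \<union> ?C"
  obtain i j where ij: "p = (i, j)" by (cases p)
  show "p \<in> diagram"
    using p durfee_le_row[of i] row_col[of i j] unfolding ij diagram_def by fastforce
qed

lemma card_diagram: "card diagram = D * D + (\<Sum>i\<in>{1..D}. r i - D) + (\<Sum>j\<in>{1..D}. c j - D)"
  unfolding diagram_split
  by (subst card_Un_disjoint, (auto)[3], subst card_Un_disjoint, (auto)[3])
    (simp add: card_image)

lemma prod_diagram:
  fixes f :: "nat \<times> nat \<Rightarrow> 'a::comm_monoid_mult"
  shows "(\<Prod>p\<in>diagram. f p) = (\<Prod>i\<in>{1..D}. \<Prod>j\<in>{1..D}. f (i, j)) *
    (\<Prod>i\<in>{1..D}. \<Prod>j\<in>{D<..r i}. f (i, j)) * (\<Prod>j\<in>{1..D}. \<Prod>i\<in>{D<..c j}. f (i, j))"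
proof -
  let ?C = "SIGMA j:{1..D}. {D<..c j}"
  have C: "prod f (prod.swap ` ?C) = (\<Prod>(j, i)\<in>?C. f (i, j))"
    by (subst prod.reindex) (simp_all add: case_prod_unfold o_def prod.swap_def inj_on_def prod_eq_iff)
  have "prod f diagram = prod f ({1..D} \<times> {1..D}) * prod f (SIGMA i:{1..D}. {D<..r i})
      * prod f (prod.swap ` ?C)"
    unfolding diagram_split
    by (subst prod.union_disjoint, (auto)[3], subst prod.union_disjoint, (auto)[3]) (rule refl)
  then show ?thesis unfolding C by (simp add: prod.Sigma)
qed

end

section \<open>Diagrams of doubled distinct partitions\<close>

locale doubled_young = young +
  assumes doubled: "1 \<le> i \<Longrightarrow> i \<le> D \<Longrightarrow> r i = c i + 1"
begin

lemma col_arm: "1 \<le> i \<Longrightarrow> i \<le> D \<Longrightarrow> c i - i = (r i - i) - 1"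
  using doubled by simp

lemma arm_pos: "1 \<le> i \<Longrightarrow> i \<le> D \<Longrightarrow> 0 < r i - i"
  using doubled[of i] durfee[of i] row_col[of i i] by simp

lemma inj_arm: "inj_on (\<lambda>i. r i - i) {1..D}"
  by (rule linorder_inj_onI') (use arm_strict_decreasing in fastforce)

text \<open>The diagonal hooks have size arm + leg + 1, and each leg is one less than its arm. The
  calculation confirms this count from the Durfee decomposition, in \<open>int\<close> to avoid
  truncated differences.\<close>

lemma card_doubled: "card diagram = 2 * (\<Sum>i\<in>{1..D}. r i - i)"
proof -
  interpret t: young c r D by (rule transpose)
  have "int (card diagram) = int D * int D + (\<Sum>i\<in>{1..D}. int (r i) - int D) + (\<Sum>i\<in>{1..D}. int (c i) - int D)"
    unfolding card_diagram using durfee_le_row t.durfee_le_row by (simp add: of_nat_diff)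
  also have "(\<Sum>i\<in>{1..D}. int (c i) - int D) = (\<Sum>i\<in>{1..D}. int (r i) - 1 - int D)"
    using doubled by (intro sum.cong) auto
  also have "int D * int D + (\<Sum>i\<in>{1..D}. int (r i) - int D) + (\<Sum>i\<in>{1..D}. int (r i) - 1 - int D)
     = 2 * (\<Sum>i\<in>{1..D}. int (r i)) - (int D * int D + int D)"
    by (simp add: sum_subtractf algebra_simps)
  also have "int D * int D + int D = 2 * (\<Sum>i\<in>{1..D}. int i)"
    by (induction D) (simp_all add: algebra_simps)
  also have "2 * (\<Sum>i\<in>{1..D}. int (r i)) - 2 * (\<Sum>i\<in>{1..D}. int i) = 2 * (\<Sum>i\<in>{1..D}. int (r i) - int i)"
    by (simp add: sum_subtractf)
  also have "(\<Sum>i\<in>{1..D}. int (r i) - int i) = (\<Sum>i\<in>{1..D}. int (r i - i))"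
    using durfee by (intro sum.cong) (auto simp: of_nat_diff)
  finally have "int (card diagram) = int (2 * (\<Sum>i\<in>{1..D}. r i - i))" by simp
  then show ?thesis by (simp only: of_nat_eq_iff)
qed

text \<open>As the arms strictly decrease, those smaller than the \<open>i\<close>-th are the ones
  with larger index.\<close>

lemma shifted_dim_arms:
  "shifted_dim ((\<lambda>i. r i - i) ` {1..D}) = (\<Prod>i\<in>{1..D}. 1 / fact (r i - i) *
    (\<Prod>k\<in>{i<..D}. (real (r i - i) - real (r k - k)) / (real (r i - i) + real (r k - k))))"
proof -
  let ?x = "\<lambda>i. r i - i"
  have "(\<Prod>b | b \<in> ?x ` {1..D} \<and> b < ?x i. (real (?x i) - real b) / (real (?x i) + real b))
     = (\<Prod>k\<in>{i<..D}. (real (?x i) - real (?x k)) / (real (?x i) + real (?x k)))"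
    if i: "i \<in> {1..D}" for i
  proof -
    have lt: "?x k < ?x i \<longleftrightarrow> i < k" if "k \<in> {1..D}" for k
      using arm_strict_decreasing[of i k] arm_strict_decreasing[of k i] i that
      by (cases i k rule: linorder_cases) auto
    have "{b. b \<in> ?x ` {1..D} \<and> b < ?x i} = ?x ` {k \<in> {1..D}. ?x k < ?x i}" by blast
    also have "{k \<in> {1..D}. ?x k < ?x i} = {i<..D}" using lt i by auto
    finally have eq: "{b. b \<in> ?x ` {1..D} \<and> b < ?x i} = ?x ` {i<..D}" .
    have "inj_on ?x {i<..D}" using i by (intro inj_on_subset[OF inj_arm]) auto
    then show ?thesis unfolding eq by (simp only: prod.reindex o_def)
  qed
  then show ?thesis unfolding shifted_dim_def prod.reindex[OF inj_arm] o_def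
    by (intro prod.cong) auto
qed

text \<open>For each \<open>i\<close>, the factor \<open>?x i\<close> of the diagonal hook length
  completes the factorial of the leg to that of the arm, which leaves a perfect square divided by
  2.\<close>

lemma prod_inverse_hooks:
  "(\<Prod>p\<in>diagram. 1 / real (hook p))
    = (shifted_dim ((\<lambda>i. r i - i) ` {1..D}))\<^sup>2 / 2 ^ card ((\<lambda>i. r i - i) ` {1..D})"
proof -
  interpret t: young c r D by (rule transpose)
  let ?x = "\<lambda>i. real (r i - i)"
  define P S where "P i = (\<Prod>k\<in>{i<..D}. ?x i - ?x k)" and "S i = (\<Prod>k\<in>{i<..D}. ?x i + ?x k)" for i
  have square: "(\<Prod>i\<in>{1..D}. \<Prod>j\<in>{1..D}. 1 / real (hook (i, j))) = (\<Prod>i\<in>{1..D}. 1 / (2 * ?x i * (S i)\<^sup>2))"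
  proof -
    have "(\<Prod>i\<in>{1..D}. \<Prod>j\<in>{1..D}. 1 / real (hook (i, j))) = (\<Prod>i\<in>{1..D}. \<Prod>j\<in>{1..D}. 1 / (?x i + ?x j))"
    proof (intro prod.cong refl)
      fix i j assume ij: "i \<in> {1..D}" "j \<in> {1..D}"
      \<comment> \<open>The \<open>+ 1\<close> in the hook length is absorbed by
        \<open>r j = c j + 1\<close>.\<close>
      then have "hook (i, j) = (r i - i) + (r j - j)"
        using durfee_le_row[of i] t.durfee_le_row[of j] doubled[of j] by (auto simp: hook_def)
      then show "1 / real (hook (i, j)) = 1 / (?x i + ?x j)" by simp
    qed
    also have "\<dots> = (\<Prod>i\<in>{1..D}. 1 / (?x i + ?x i) * (\<Prod>k\<in>{i<..D}. 1 / (?x i + ?x k))\<^sup>2)"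
      by (rule prod_symmetric_square) (simp add: add.commute)
    finally show ?thesis by (simp add: S_def prod_dividef power_divide)
  qed
  have rows: "(\<Prod>i\<in>{1..D}. \<Prod>j\<in>{D<..r i}. 1 / real (hook (i, j))) = (\<Prod>i\<in>{1..D}. P i / fact (r i - i))"
    unfolding hook_def prod.case P_def by (intro prod.cong refl row_product_inverse) auto
  have cols: "(\<Prod>j\<in>{1..D}. \<Prod>i\<in>{D<..c j}. 1 / real (hook (i, j))) = (\<Prod>i\<in>{1..D}. P i / fact (r i - i - 1))"
  proof (intro prod.cong refl)
    fix j assume j: "j \<in> {1..D}"
    have "(\<Prod>i\<in>{D<..c j}. 1 / real (hook (i, j))) = (\<Prod>i\<in>{D<..c j}. 1 / real ((c j - i) + (r i - j) + 1))"
      by (simp add: hook_def add.commute)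
    also have "\<dots> = (\<Prod>k\<in>{j<..D}. real (c j - j) - real (c k - k)) / fact (c j - j)"
      using j by (intro t.row_product_inverse) auto
    \<comment> \<open>Legs are arms lowered by 1, so their differences agree; \<open>arm_pos\<close>
      keeps the subtraction exact.\<close>
    also have "(\<Prod>k\<in>{j<..D}. real (c j - j) - real (c k - k)) = P j"
      unfolding P_def
    proof (intro prod.cong refl)
      fix k assume "k \<in> {j<..D}"
      then show "real (c j - j) - real (c k - k) = ?x j - ?x k"
        using j arm_pos[of j] arm_pos[of k] col_arm[of j] col_arm[of k] by (simp add: of_nat_diff)
    qed
    also have "c j - j = r j - j - 1" using j col_arm by simp
    finally show "(\<Prod>i\<in>{D<..c j}. 1 / real (hook (i, j))) = P j / fact (r j - j - 1)" .
  qed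
  have "(\<Prod>p\<in>diagram. 1 / real (hook p))
    = (\<Prod>i\<in>{1..D}. 1 / (2 * ?x i * (S i)\<^sup>2) * (P i / fact (r i - i)) * (P i / fact (r i - i - 1)))"
    unfolding prod_diagram square rows cols by (simp only: prod.distrib)
  also have "\<dots> = (\<Prod>i\<in>{1..D}. (1 / fact (r i - i) * (P i / S i))\<^sup>2 / 2)"
  proof (intro prod.cong refl)
    fix i assume i: "i \<in> {1..D}"
    then have pos: "0 < r i - i" using arm_pos by simp
    then have "(fact (r i - i) :: real) = ?x i * fact (r i - i - 1)"
      by (rule fact_reduce)
    then show "1 / (2 * ?x i * (S i)\<^sup>2) * (P i / fact (r i - i)) * (P i / fact (r i - i - 1))
      = (1 / fact (r i - i) * (P i / S i))\<^sup>2 / 2"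
      by (simp add: power2_eq_square)
  qed
  also have "\<dots> = (shifted_dim ((\<lambda>i. r i - i) ` {1..D}))\<^sup>2 / 2 ^ D"
  proof -
    have "shifted_dim ((\<lambda>i. r i - i) ` {1..D}) = (\<Prod>i\<in>{1..D}. 1 / fact (r i - i) * (P i / S i))"
      unfolding shifted_dim_arms P_def S_def prod_dividef ..
    then show ?thesis
      by (simp only: prod_dividef prod_power_distrib prod_constant card_atLeastAtMost diff_Suc_1)
  qed
  finally show ?thesis using card_image[OF inj_arm] by simp
qed

end

section \<open>Reconstruction of a doubled diagram from its arms\<close>

text \<open>The arms give \<open>D\<close> and the first \<open>D\<close> rows, doubling then gives
  the first \<open>D\<close> columns, and every box lies in one of these rows or columns.\<close>

lemma doubled_young_eqI:
  assumes "doubled_young r c D" "doubled_young r' c' D'"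
    and eq: "(\<lambda>i. r i - i) ` {1..D} = (\<lambda>i. r' i - i) ` {1..D'}" and "1 \<le> i"
  shows "r i = r' i"
proof -
  interpret doubled_young r c D by fact
  interpret y': doubled_young r' c' D' by fact
  have D: "D' = D" using eq card_image[OF inj_arm] card_image[OF y'.inj_arm] by simp
  have x: "r i - i = r' i - i" if "1 \<le> i" "i \<le> D" for i
    using strictly_decreasing_enumeration_unique[of D "\<lambda>i. r i - i" "\<lambda>i. r' i - i" i] that
      arm_strict_decreasing y'.arm_strict_decreasing eq unfolding D by auto
  have r: "r i = r' i" if "1 \<le> i" "i \<le> D" for i
    using x[of i] durfee[of i] y'.durfee[of i] D that by auto
  have c: "c i = c' i" if "1 \<le> i" "i \<le> D" for i
    using r[of i] doubled[of i] y'.doubled[of i] D that by auto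
  have mem: "j \<le> r i \<longleftrightarrow> j \<le> r' i" if "1 \<le> j" for j
  proof (cases "i \<le> D \<or> D < j")
    case True
    then show ?thesis
      using r[of i] mem_durfee[of i j] y'.mem_durfee[of i j] D that assms(4) by auto
  next
    case False
    then show ?thesis
      using c[of j] row_col[of i j] y'.row_col[of i j] D that assms(4) by auto
  qed
  show ?thesis using mem[of "r i"] mem[of "r' i"] by (cases "r i = 0"; cases "r' i = 0") auto
qed

text \<open>Arms and legs prescribe the rows and columns up to \<open>D\<close>; those beyond are
  found by counting which of the first \<open>D\<close> columns or rows reach them.\<close>

lemma doubled_young_exists:
  assumes "finite A" "0 \<notin> A"
  obtains r c D where "doubled_young r c D" "(\<lambda>i. r i - i) ` {1..D} = A"
proof -
  define D where "D = card A"
  define x where "x i = rev (sorted_list_of_set A) ! (i - 1)" for i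
  have len: "length (rev (sorted_list_of_set A)) = D" by (simp add: D_def)
  have "(\<lambda>i. x i) ` {1..D} = (\<lambda>i. rev (sorted_list_of_set A) ! i) ` {0..<D}"
  proof -
    have "{0..<D} = (\<lambda>i. i - 1) ` {1..D}"
      by (auto simp: image_iff intro!: bexI[of _ "Suc _"])
    then show ?thesis by (simp add: x_def image_image)
  qed
  also have "\<dots> = A"
    unfolding len[symmetric] nth_image[OF order.refl]
    using assms(1) by simp
  finally have img: "x ` {1..D} = A" .
  have "sorted_wrt (>) (rev (sorted_list_of_set A))"
    by (simp add: sorted_wrt_rev)
  then have dec: "x k < x i" if "1 \<le> i" "i < k" "k \<le> D" for i k
    using that len sorted_wrt_nth_less[of "(>)" "rev (sorted_list_of_set A)" "i - 1" "k - 1"]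
    unfolding x_def by simp
  have pos: "0 < x i" if "1 \<le> i" "i \<le> D" for i
    using that img assms(2) by (metis atLeastAtMost_iff gr0I imageI)
  \<comment> \<open>The future row lengths \<open>x i + i\<close> decrease weakly.\<close>
  have anti: "x k + k \<le> x i + i" if "i \<le> k" "1 \<le> i" "k \<le> D" for i k
    using that
  proof (induction k rule: dec_induct)
    case (step k)
    then show ?case using dec[of k "Suc k"] by simp
  qed simp
  \<comment> \<open>Rows up to \<open>D\<close> end strictly beyond the Durfee square, so the
    columns, one shorter, still fill it.\<close>
  have big: "D < x i + i" if "1 \<le> i" "i \<le> D" for i
    using anti[of i D] pos[of D] that by simp
  \<comment> \<open>The rows among the first \<open>D\<close> that reach column
    \<open>j\<close>.\<close>
  define R where "R j = {k. 1 \<le> k \<and> k \<le> D \<and> j \<le> x k + k}" for j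
  have finR: "finite (R j)" for j unfolding R_def by simp
  have R: "i \<in> R j \<longleftrightarrow> i \<le> card (R j)" if "1 \<le> i" for i j
  proof (rule down_closed_mem_iff[OF finR])
    fix i k assume "k \<in> R j" "1 \<le> i" "i \<le> k"
    then show "i \<in> R j" using anti[of i k] by (simp add: R_def)
  qed (use that in \<open>auto simp: R_def\<close>)
  have cardR: "card (R j) \<le> D" for j
  proof -
    have "card (R j) \<le> card {1..D}" by (rule card_mono) (auto simp: R_def)
    then show ?thesis by simp
  qed
  \<comment> \<open>Column \<open>j \<le> D\<close> has length \<open>x j + j - 1\<close>, so it
    reaches row \<open>i\<close> iff \<open>Suc i \<le> x j + j\<close>; hence
    \<open>R (Suc i)\<close>.\<close>
  define r where "r i = (if i \<le> D then x i + i else card (R (Suc i)))" for i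
  define c where "c j = (if j \<le> D then x j + j - 1 else card (R j))" for j
  have "doubled_young r c D"
  proof unfold_locales
    fix i j :: nat assume ij: "1 \<le> i" "1 \<le> j"
    consider "i \<le> D" "j \<le> D" | "i \<le> D" "D < j" | "D < i" "j \<le> D" | "D < i" "D < j" by linarith
    then show "j \<le> r i \<longleftrightarrow> i \<le> c j"
    proof cases
      case 1
      then show ?thesis using ij big[of i] big[of j] by (simp add: r_def c_def)
    next
      case 2
      then show ?thesis using ij R[of i j] by (simp add: r_def c_def R_def)
    next
      case 3
      then show ?thesis using ij R[of j "Suc i"] by (auto simp: r_def c_def R_def)
    next
      case 4
      then show ?thesis using cardR[of "Suc i"] cardR[of j] by (simp add: r_def c_def)
    qed
  next
    fix i :: nat assume "1 \<le> i"
    then show "i \<le> r i \<longleftrightarrow> i \<le> D" using cardR[of "Suc i"] by (auto simp: r_def)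
  next
    fix i :: nat assume "1 \<le> i" "i \<le> D"
    then show "r i = c i + 1" using pos[of i] by (simp add: r_def c_def)
  qed
  moreover have "(\<lambda>i. r i - i) ` {1..D} = A"
    unfolding img[symmetric] by (rule image_cong) (auto simp: r_def)
  ultimately show thesis by (rule that)
qed

section \<open>Translation between lists of parts and Young diagrams\<close>

lemma part_antimono:
  assumes "is_partition xs" "1 \<le> i" "i \<le> k"
  shows "part xs k \<le> part xs i"
proof (cases "i < k \<and> k \<le> length xs")
  case True
  then show ?thesis
    using assms sorted_wrt_nth_less[of "(\<ge>)" xs "i - 1" "k - 1"]
    by (auto simp: is_partition_def part_def)
next
  case False
  then show ?thesis using assms by (cases "i = k") (auto simp: part_def)
qed

lemma mem_boxes: "(i, j) \<in> boxes xs \<longleftrightarrow> 1 \<le> i \<and> 1 \<le> j \<and> j \<le> part xs i"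
  by (auto simp: boxes_def part_def split: if_splits)

text \<open>Beyond the last column, the default value 0 of \<open>part\<close> agrees with the count
  of an empty column.\<close>

lemma part_conjugate:
  assumes "is_partition xs" "1 \<le> j"
  shows "part (conjugate xs) j = card {i. (i, j) \<in> boxes xs}"
proof (cases "j \<le> part xs 1")
  case True
  have "part (map f [1..<m + 1]) j = f j" if "j \<le> m" for f m
    using that assms(2) by (simp add: part_def del: upt_Suc)
  then show ?thesis using True unfolding conjugate_def by blast
next
  case False
  then have "{i. (i, j) \<in> boxes xs} = {}"
    using part_antimono[OF assms(1), of 1] by (force simp: mem_boxes)
  then show ?thesis using False by (simp add: part_def conjugate_def)
qed

text \<open>Columns and the set of diagonal boxes are initial segments, so both conditions come from
  \<open>down_closed_mem_iff\<close>.\<close>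

lemma young_partition:
  assumes "is_partition xs"
  shows "young (part xs) (part (conjugate xs)) (durfee_length xs)"
proof
  fix i j :: nat assume ij: "1 \<le> i" "1 \<le> j"
  have "finite {i. (i, j) \<in> boxes xs}"
    by (rule finite_subset[of _ "fst ` boxes xs"]) (force simp: finite_boxes)+
  then have "i \<in> {i. (i, j) \<in> boxes xs} \<longleftrightarrow> i \<le> card {i. (i, j) \<in> boxes xs}"
    using ij by (intro down_closed_mem_iff)
      (auto simp: mem_boxes intro: order_trans[OF _ part_antimono[OF assms]])
  then show "j \<le> part xs i \<longleftrightarrow> i \<le> part (conjugate xs) j"
    using ij by (simp add: mem_boxes part_conjugate[OF assms])
next
  fix i :: nat assume i: "1 \<le> i"
  let ?S = "{i. 1 \<le> i \<and> i \<le> length xs \<and> i \<le> part xs i}"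
  have "i \<in> ?S \<longleftrightarrow> i \<le> card ?S"
  proof (rule down_closed_mem_iff)
    fix i k assume "k \<in> ?S" "1 \<le> i" "i \<le> k"
    then show "i \<in> ?S" using part_antimono[OF assms, of i k] by simp
  qed (use i in auto)
  moreover have "i \<in> ?S \<longleftrightarrow> i \<le> part xs i" using i by (simp add: part_def)
  ultimately show "i \<le> part xs i \<longleftrightarrow> i \<le> durfee_length xs"
    unfolding durfee_length_def by blast
qed

lemma weight_eq_card_boxes: "weight xs = card (boxes xs)"
proof -
  have "boxes xs = (SIGMA i:{1..length xs}. {1..part xs i})"
    by (auto simp: boxes_def)
  then have "card (boxes xs) = (\<Sum>i\<in>{1..length xs}. part xs i)" by simp
  also have "\<dots> = (\<Sum>i\<in>{0..<length xs}. xs ! i)"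
    by (rule sum.reindex_bij_witness[where i = Suc and j = "\<lambda>i. i - 1"]) (auto simp: part_def)
  finally show ?thesis by (simp add: weight_def sum_list_sum_nth)
qed

text \<open>Parts are positive, so the length is recovered as the last index where
  \<open>part\<close> is nonzero.\<close>

lemma partition_eqI:
  assumes "is_partition xs" "is_partition ys" "\<And>i. 1 \<le> i \<Longrightarrow> part xs i = part ys i"
  shows "xs = ys"
proof -
  have pos: "0 < part zs i \<longleftrightarrow> i \<le> length zs" if "is_partition zs" "1 \<le> i" for zs i
    using that by (auto simp: is_partition_def part_def)
  have "length xs = length ys"
    using pos[OF assms(1), of "length xs"] pos[OF assms(2), of "length xs"]
      pos[OF assms(1), of "length ys"] pos[OF assms(2), of "length ys"]
      assms(3)[of "length xs"] assms(3)[of "length ys"]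
    by (cases "length xs = 0"; cases "length ys = 0") (auto simp: Suc_le_eq)
  then show ?thesis
  proof (rule nth_equalityI)
    fix i assume "i < length xs"
    then show "xs ! i = ys ! i"
      using assms(3)[of "Suc i"] \<open>length xs = length ys\<close> by (simp add: part_def)
  qed
qed

lemma partition_of_young:
  assumes "young r c D"
  obtains xs where "is_partition xs" "\<And>i. 1 \<le> i \<Longrightarrow> part xs i = r i"
proof
  interpret young r c D by fact
  \<comment> \<open>Row \<open>i\<close> is nonempty iff it meets the first column, that is, iff
    \<open>i \<le> c 1\<close>.\<close>
  let ?xs = "map r [1..<Suc (c 1)]"
  have "sorted_wrt (\<lambda>i k. r k \<le> r i) [1..<Suc (c 1)]"
    by (rule sorted_wrt_mono_rel[OF _ sorted_wrt_upt]) (auto intro: row_antimono)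
  then have "sorted_wrt (\<ge>) ?xs" by (simp only: sorted_wrt_map)
  moreover have "0 < r i" if "i \<in> {1..c 1}" for i using that row_col[of i 1] by auto
  ultimately show "is_partition ?xs" by (auto simp: is_partition_def)
  show "part ?xs i = r i" if "1 \<le> i" for i
    using that row_col[of i 1] by (auto simp: part_def simp del: upt_Suc)
qed

text \<open>Serves to identify the conjugate and Durfee length computed from a list with the
  \<open>c\<close> and \<open>D\<close> of the diagram that it was built from.\<close>

lemma young_unique:
  assumes "young r c D" "young r' c' D'" "\<And>i. 1 \<le> i \<Longrightarrow> r i = r' i"
  shows "D = D'" "1 \<le> j \<Longrightarrow> c j = c' j"
proof -
  interpret young r c D by fact
  interpret y': young r' c' D' by fact
  have "i \<le> D \<longleftrightarrow> i \<le> D'" if "1 \<le> i" for i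
    using durfee[of i] y'.durfee[of i] assms(3)[of i] that by simp
  from this[of D] this[of D'] show "D = D'" by (cases "D = 0"; cases "D' = 0") auto
  assume j: "1 \<le> j"
  have "i \<le> c j \<longleftrightarrow> i \<le> c' j" if "1 \<le> i" for i
    using row_col[of i j] y'.row_col[of i j] assms(3)[of i] that j by simp
  from this[of "c j"] this[of "c' j"] show "c j = c' j" by (cases "c j = 0"; cases "c' j = 0") auto
qed

section \<open>The correspondence between doubled distinct and strict partitions\<close>

lemma doubled_distinct_iff:
  "xs \<in> doubled_distinct \<longleftrightarrow>
    is_partition xs \<and> doubled_young (part xs) (part (conjugate xs)) (durfee_length xs)"
  unfolding doubled_distinct_def doubled_young_def doubled_young_axioms_def
  using young_partition by auto

text \<open>The arms on the diagonal. For a partition they strictly decrease, so a set records them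
  without loss.\<close>

definition strict_part_set :: "nat list \<Rightarrow> nat set" where
  "strict_part_set xs = (\<lambda>i. part xs i - i) ` {1..durfee_length xs}"

lemma boxes_eq_diagram:
  assumes "is_partition xs"
  shows "boxes xs = young.diagram (part xs)"
  using young.diagram_def[OF young_partition[OF assms]] mem_boxes by auto

lemma weight_doubled_distinct:
  assumes "xs \<in> doubled_distinct"
  shows "weight xs = 2 * \<Sum>(strict_part_set xs)"
proof -
  from assms interpret doubled_young "part xs" "part (conjugate xs)" "durfee_length xs"
    by (simp add: doubled_distinct_iff)
  have "boxes xs = diagram" using assms boxes_eq_diagram by (simp add: doubled_distinct_iff)
  then show ?thesis
    unfolding weight_eq_card_boxes strict_part_set_def sum.reindex[OF inj_arm]
    by (simp add: card_doubled)
qed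

lemma prod_hook_lengths_doubled_distinct:
  assumes "xs \<in> doubled_distinct"
  shows "(\<Prod>h\<in>#hook_lengths xs. 1 / real h)
    = (shifted_dim (strict_part_set xs))\<^sup>2 / 2 ^ card (strict_part_set xs)"
proof -
  from assms interpret doubled_young "part xs" "part (conjugate xs)" "durfee_length xs"
    by (simp add: doubled_distinct_iff)
  have "boxes xs = diagram" using assms boxes_eq_diagram by (simp add: doubled_distinct_iff)
  moreover have "hook_length xs = hook" by (simp add: hook_length_def hook_def)
  ultimately have "(\<Prod>h\<in>#hook_lengths xs. 1 / real h) = (\<Prod>p\<in>diagram. 1 / real (hook p))"
    by (simp add: hook_lengths_def prod_unfold_prod_mset multiset.map_comp o_def)
  then show ?thesis unfolding strict_part_set_def prod_inverse_hooks .
qed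

text \<open>Injectivity rests on \<open>doubled_young_eqI\<close>, surjectivity on
  \<open>doubled_young_exists\<close> followed by \<open>partition_of_young\<close>;
  \<open>weight_doubled_distinct\<close> matches the weights \<open>2 * n\<close> and
  \<open>n\<close>.\<close>

lemma bij_betw_strict_part_set:
  "bij_betw strict_part_set {xs \<in> doubled_distinct. weight xs = 2 * n} (strict_partitions n)"
proof (rule bij_betwI')
  fix xs ys
  assume "xs \<in> {xs \<in> doubled_distinct. weight xs = 2 * n}" "ys \<in> {xs \<in> doubled_distinct. weight xs = 2 * n}"
  then have xy: "is_partition xs" "is_partition ys"
    "doubled_young (part xs) (part (conjugate xs)) (durfee_length xs)"
    "doubled_young (part ys) (part (conjugate ys)) (durfee_length ys)"
    by (simp_all add: doubled_distinct_iff)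
  show "strict_part_set xs = strict_part_set ys \<longleftrightarrow> xs = ys"
    using partition_eqI[OF xy(1,2)] doubled_young_eqI[OF xy(3,4)]
    unfolding strict_part_set_def by blast
next
  fix xs assume xs: "xs \<in> {xs \<in> doubled_distinct. weight xs = 2 * n}"
  then interpret doubled_young "part xs" "part (conjugate xs)" "durfee_length xs"
    by (simp add: doubled_distinct_iff)
  have "0 \<notin> strict_part_set xs" using arm_pos by (force simp: strict_part_set_def)
  moreover have "finite (strict_part_set xs)" by (simp add: strict_part_set_def)
  ultimately show "strict_part_set xs \<in> strict_partitions n"
    using weight_doubled_distinct[of xs] xs by (simp add: strict_partitions_def)
next
  fix A assume A: "A \<in> strict_partitions n"
  then have "finite A" "0 \<notin> A" by (simp_all add: strict_partitions_def)
  then obtain r c D where y: "doubled_young r c D" "(\<lambda>i. r i - i) ` {1..D} = A"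
    by (rule doubled_young_exists)
  then have yr: "young r c D" by (simp add: doubled_young_def)
  then obtain xs where xs: "is_partition xs" "\<And>i. 1 \<le> i \<Longrightarrow> part xs i = r i"
    by (rule partition_of_young) blast
  have D: "durfee_length xs = D" and c: "1 \<le> j \<Longrightarrow> part (conjugate xs) j = c j" for j
    using young_unique[OF young_partition[OF xs(1)] yr] xs(2) by blast+
  have dd: "xs \<in> doubled_distinct"
    using xs D c doubled_young.doubled[OF y(1)] by (simp add: doubled_distinct_def)
  moreover have set: "strict_part_set xs = A"
    unfolding strict_part_set_def y(2)[symmetric] D by (rule image_cong) (simp_all add: xs)
  ultimately show "\<exists>xs\<in>{xs \<in> doubled_distinct. weight xs = 2 * n}. A = strict_part_set xs"
    using weight_doubled_distinct[OF dd] A by (auto simp: strict_partitions_def)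
qed

theorem corollary3p11:
  fixes n :: nat
  assumes "n > 0"
  shows "(\<Sum>xs\<in>{xs \<in> doubled_distinct. weight xs = 2 * n}.
            \<Prod>h\<in>#hook_lengths xs. 1 / real h) = 1 / (2 ^ n * fact n)"
proof -
  have "(\<Sum>xs\<in>{xs \<in> doubled_distinct. weight xs = 2 * n}. \<Prod>h\<in>#hook_lengths xs. 1 / real h)
    = (\<Sum>xs\<in>{xs \<in> doubled_distinct. weight xs = 2 * n}.
        (shifted_dim (strict_part_set xs))\<^sup>2 / 2 ^ card (strict_part_set xs))"
    by (intro sum.cong refl prod_hook_lengths_doubled_distinct) simp
  also have "\<dots> = (\<Sum>A\<in>strict_partitions n. (shifted_dim A)\<^sup>2 / 2 ^ card A)"
    by (rule sum.reindex_bij_betw[OF bij_betw_strict_part_set])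
  also have "\<dots> = 1 / (2 ^ n * fact n)"
    by (rule sum_shifted_dim_squared)
  finally show ?thesis .
qed

end
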